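(* For any integer $k\ge0$, the sequence $\left(\binom{n+k}{k}\right)_{n\ge0}$ is log-concave.
   Context: A real sequence $(a_n)_{n\ge0}$ is log-concave if $a_n^2\ge a_{n-1}a_{n+1}$ for all $n\ge1$. *)

theory Defs
  imports Complex_Main
begin

definition log_concave_seq :: "(nat \<Rightarrow> real) \<Rightarrow> bool" where
  "log_concave_seq a \<longleftrightarrow> (\<forall>n\<ge>1. (a n)\<^sup>2 \<ge> a (n - 1) * a (n + 1))"

end

theory Submission
  imports Defs
begin

text \<open>
  The quotient of consecutive terms of \<open>b n = (n + k) choose k\<close> is
  \<open>b (n + 1) / b n = 1 + k / (n + 1)\<close>, which does not increase with \<open>n\<close>.  For positive
  sequences, nonincreasing quotients are the same as log-concavity.  The proof clears the
  denominators, so that only the two instances of the quotient identity and the inequality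
  \<open>(m + 1) (m + 2 + k) \<le> (m + 2) (m + 1 + k)\<close> remain; the two sides of the latter differ
  by exactly \<open>k\<close>.
\<close>

lemma binomial_quotient_identity:
  "Suc n * (Suc n + k choose k) = (Suc n + k) * (n + k choose k)"
  using binomial_absorb_comp[of "Suc n + k" k] by simp

lemma binomial_consecutive_product_le_square:
  "(m + k choose k) * (Suc (Suc m) + k choose k) \<le> (Suc m + k choose k)\<^sup>2"
proof -
  define a b c where
    "a = (m + k choose k)" and
    "b = (Suc m + k choose k)" and
    "c = (Suc (Suc m) + k choose k)"
  have ab: "Suc m * b = (Suc m + k) * a"
    unfolding a_def b_def by (rule binomial_quotient_identity)
  have bc: "Suc (Suc m) * c = (Suc (Suc m) + k) * b"
    unfolding b_def c_def by (rule binomial_quotient_identity)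
  let ?d = "(Suc m + k) * Suc (Suc m)"
  have "?d * (a * c) = ((Suc m + k) * a) * (Suc (Suc m) * c)"
    by (simp only: mult_ac)
  also have "\<dots> = (Suc m * (Suc (Suc m) + k)) * b\<^sup>2"
    unfolding ab[symmetric] bc by (simp only: mult_ac power2_eq_square)
  also have "\<dots> \<le> ?d * b\<^sup>2"
    by (rule mult_right_mono) (simp_all add: algebra_simps)
  finally have "a * c \<le> b\<^sup>2"
    by (subst (asm) mult_le_cancel1) simp
  then show ?thesis
    unfolding a_def b_def c_def .
qed

theorem corollary3p2:
  fixes k :: nat
  shows "log_concave_seq (\<lambda>n. real ((n + k) choose k))"
  unfolding log_concave_seq_def
proof (intro allI impI)
  fix n :: nat
  assume "n \<ge> 1"
  then obtain m where n: "n = Suc m"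
    by (cases n) auto
  have "real ((m + k choose k) * (Suc (Suc m) + k choose k)) \<le> real ((Suc m + k choose k)\<^sup>2)"
    by (simp only: of_nat_le_iff binomial_consecutive_product_le_square)
  then show "real (n - 1 + k choose k) * real (n + 1 + k choose k) \<le> (real (n + k choose k))\<^sup>2"
    unfolding n by simp
qed

end
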